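(* Let $b=(b_1,b_2,b_3):\mathbb R^3\to\mathbb R^3$ be a continuous function such that each $b_i$ depends only on $x_i$, i.e. $b_i(x)=b_i(x_i)$, and, for some constants $\alpha\ge0$, $R>0$, $C_i>0$ $(i=1,2,3)$, $$b_i(x_i)\le -\frac{C_i}{|x_i|^{1-\alpha}}\ \text{ for } x_i\ge R,\qquad b_i(x_i)\ge \frac{C_i}{|x_i|^{1-\alpha}}\ \text{ for } x_i\le -R .$$ Assume that (i) either $\alpha>0$, (ii) or $\alpha=0$ and the $C_i$ are sufficiently large. Then there exist $R_0>0$ and a $C^\infty$ function $w$ on $\mathbb R^3$ which satisfies $$\mathcal L_\rho w\ge1\ \text{ in }\ \mathbb R^3\setminus\overline{B(0,R_0)},\qquad w\ge0\ \text{ in }\ \mathbb R^3\setminus\overline{B(0,R_0)},\qquad \lim_{|x|\to\infty}w(x)=+\infty$$ for $\rho>0$ sufficiently small.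
   Context: $B(0,R_0)$ is the open Euclidean ball centered at $0$ with radius $R_0$. With $\sigma(x)=\begin{pmatrix}1&0\\0&1\\2x_2&-2x_1\end{pmatrix}$ for $x=(x_1,x_2,x_3)\in\mathbb R^3$, set for $\rho>0$ $$A_\rho(x)=\sigma(x)\sigma^T(x)+\begin{pmatrix}0&0&0\\0&0&0\\0&0&\rho^2\end{pmatrix}=\begin{pmatrix}1&0&2x_2\\0&1&-2x_1\\2x_2&-2x_1&4(x_1^2+x_2^2)+\rho^2\end{pmatrix}$$ and $\mathcal L_\rho w=-\mathrm{tr}(A_\rho(x)D^2w)-b(x)\cdot Dw$. *)

theory Defs
  imports "HOL-Analysis.Analysis"
begin

definition partial :: "'n \<Rightarrow> (real^'n \<Rightarrow> real) \<Rightarrow> real^'n \<Rightarrow> real" where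
  "partial i f x = frechet_derivative f (at x) (axis i 1)"

primrec Ck :: "nat \<Rightarrow> (real^'n \<Rightarrow> real) \<Rightarrow> bool" where
  "Ck 0 f \<longleftrightarrow> continuous_on UNIV f"
| "Ck (Suc k) f \<longleftrightarrow> (\<forall>x. f differentiable (at x)) \<and> (\<forall>i. Ck k (partial i f))"

definition C_infinity :: "(real^'n \<Rightarrow> real) \<Rightarrow> bool" where
  "C_infinity f \<longleftrightarrow> (\<forall>k. Ck k f)"

definition gradient :: "(real^'n \<Rightarrow> real) \<Rightarrow> real^'n \<Rightarrow> real^'n" where
  "gradient f x = (\<chi> i. partial i f x)"

definition hessian :: "(real^'n \<Rightarrow> real) \<Rightarrow> real^'n \<Rightarrow> real^'n^'n" where
  "hessian f x = (\<chi> i j. partial i (partial j f) x)"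

definition sigma :: "real^3 \<Rightarrow> real^2^3" where
  "sigma x = vector [vector [1, 0], vector [0, 1], vector [2 * x$2, - 2 * x$1]]"

definition A :: "real \<Rightarrow> real^3 \<Rightarrow> real^3^3" where
  "A \<rho> x = sigma x ** transpose (sigma x)
     + vector [vector [0, 0, 0], vector [0, 0, 0], vector [0, 0, \<rho>^2]]"

lemma A_explicit:
  "A \<rho> x = vector
     [vector [1, 0, 2 * x$2],
      vector [0, 1, - 2 * x$1],
      vector [2 * x$2, - 2 * x$1, 4 * ((x$1)^2 + (x$2)^2) + \<rho>^2]]"
  by (simp add: A_def sigma_def vec_eq_iff forall_3 sum_2 matrix_matrix_mult_def
      transpose_def power2_eq_square algebra_simps)

definition L :: "(real^3 \<Rightarrow> real^3) \<Rightarrow> real \<Rightarrow> (real^3 \<Rightarrow> real) \<Rightarrow> real^3 \<Rightarrow> real" where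
  "L b \<rho> w x = - trace (A \<rho> x ** hessian w x) - b x \<bullet> gradient w x"

text \<open>The constants \<open>C\<^sub>i\<close> are the components of the vector \<open>C\<close>.\<close>
definition confining_drift :: "(real^3 \<Rightarrow> real^3) \<Rightarrow> real \<Rightarrow> real \<Rightarrow> real^3 \<Rightarrow> bool" where
  "confining_drift b \<alpha> R C \<longleftrightarrow>
     continuous_on UNIV b \<and>
     (\<forall>i x y. x$i = y$i \<longrightarrow> b x $ i = b y $ i) \<and>
     (\<forall>i x. x$i \<ge> R \<longrightarrow> b x $ i \<le> - (C$i / \<bar>x$i\<bar> powr (1 - \<alpha>))) \<and>
     (\<forall>i x. x$i \<le> - R \<longrightarrow> b x $ i \<ge> C$i / \<bar>x$i\<bar> powr (1 - \<alpha>))"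

end

theory Submission
  imports Defs
begin

text \<open>
  The Lyapunov function is \<open>w(x) = f(x\<^sub>1) + f(x\<^sub>2) + x\<^sub>3\<^sup>2/2\<close>, where \<open>f\<close> grows like \<open>t\<^sup>4/2\<close>, so that
  \<open>-b\<^sub>i f'\<close> absorbs both \<open>f''\<close> and the degenerate term \<open>4 x\<^sub>i\<^sup>2 \<partial>\<^sub>3\<^sub>3 w = 4 x\<^sub>i\<^sup>2\<close>; what is left to control
  where \<open>x\<^sub>1\<close> and \<open>x\<^sub>2\<close> stay bounded is a constant, and \<open>-b\<^sub>3 x\<^sub>3\<close> does this for large \<open>\<bar>x\<^sub>3\<bar>\<close>.
  For \<open>\<alpha> = 0\<close> this constant has to be independent of \<open>b\<close>, which is not controlled on \<open>[-R, R]\<close>.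
  Therefore \<open>f(t) = \<phi>(t\<^sup>2 - 2 R\<^sup>2)\<close>, where \<open>\<phi>\<close> is the regularisation
  \<open>(s + sqrt (s\<^sup>2 + E))\<^sup>2 / 8\<close> of \<open>max 0 s ^ 2 / 2\<close>: its derivative is arbitrarily small on \<open>[-R, R]\<close> as
  \<open>E\<close> tends to \<open>0\<close>, whereas its second derivative is bounded uniformly in \<open>E\<close>.
  For \<open>\<alpha> > 0\<close> the same function works with \<open>R\<close> replaced by a large radius.
\<close>

section \<open>Smoothness\<close>

text \<open>A class of expressions closed under differentiation, so that smoothness needs no
  computation of higher partial derivatives. The side conditions of \<open>inverse\<close> and
  \<open>sqrt\<close> keep every member differentiable everywhere.\<close>

inductive elementary :: "(real^'n \<Rightarrow> real) \<Rightarrow> bool" where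
  const: "elementary (\<lambda>x. c)"
| coord: "elementary (\<lambda>x. x $ i)"
| add: "elementary f \<Longrightarrow> elementary g \<Longrightarrow> elementary (\<lambda>x. f x + g x)"
| mult: "elementary f \<Longrightarrow> elementary g \<Longrightarrow> elementary (\<lambda>x. f x * g x)"
| inverse: "elementary f \<Longrightarrow> (\<And>x. f x \<noteq> 0) \<Longrightarrow> elementary (\<lambda>x. inverse (f x))"
| sqrt: "elementary f \<Longrightarrow> (\<And>x. f x > 0) \<Longrightarrow> elementary (\<lambda>x. sqrt (f x))"

lemma partial_eqI:
  assumes "(f has_derivative D) (at x)"
  shows "partial i f x = D (axis i 1)"
  using frechet_derivative_at[OF assms] by (simp add: partial_def)

text \<open>Each differentiation rule stays inside the class once the direction \<open>v\<close> is
  fixed; this closure drives the induction on the order in \<open>Ck_elementary\<close>.\<close>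

lemma elementary_has_derivative:
  assumes "elementary f"
  shows "\<exists>D. (\<forall>x. (f has_derivative D x) (at x)) \<and> (\<forall>v. elementary (\<lambda>x. D x v))"
  using assms
proof induction
  case (const c)
  show ?case
    by (rule exI[of _ "\<lambda>x v. 0"]) (auto intro: elementary.const)
next
  case (coord i)
  show ?case
    by (rule exI[of _ "\<lambda>x v. v $ i"])
      (auto intro!: elementary.const bounded_linear_imp_has_derivative bounded_linear_vec_nth)
next
  case (add f g)
  then obtain D D' where "\<forall>x. (f has_derivative D x) (at x)" "\<forall>v. elementary (\<lambda>x. D x v)"
    "\<forall>x. (g has_derivative D' x) (at x)" "\<forall>v. elementary (\<lambda>x. D' x v)"
    by blast
  then show ?case
    by (intro exI[of _ "\<lambda>x v. D x v + D' x v"])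
      (auto intro: elementary.add has_derivative_add)
next
  case (mult f g)
  then obtain D D' where "\<forall>x. (f has_derivative D x) (at x)" "\<forall>v. elementary (\<lambda>x. D x v)"
    "\<forall>x. (g has_derivative D' x) (at x)" "\<forall>v. elementary (\<lambda>x. D' x v)"
    by blast
  then show ?case using mult.hyps
    by (intro exI[of _ "\<lambda>x v. f x * D' x v + D x v * g x"])
      (intro conjI allI elementary.intros; blast intro: has_derivative_mult)
next
  case (inverse f)
  then obtain D where D: "\<forall>x. (f has_derivative D x) (at x)" "\<forall>v. elementary (\<lambda>x. D x v)"
    by blast
  \<comment> \<open>The derivative is spelled with products, \<open>inverse\<close> and the constant
    \<open>- 1\<close>, so that the introduction rules of \<open>elementary\<close> match
    it.\<close>
  have "((\<lambda>x. inverse (f x)) has_derivative (\<lambda>v. - 1 * (inverse (f x) * (D x v * inverse (f x))))) (at x)"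
    for x
    using Deriv.has_derivative_inverse[OF inverse.hyps(2) D(1)[rule_format], of x]
    by (simp add: mult.assoc)
  then show ?case using D inverse.hyps
    by (intro exI[of _ "\<lambda>x v. - 1 * (inverse (f x) * (D x v * inverse (f x)))"])
      (intro conjI allI elementary.intros; blast intro: elementary.intros)
next
  case (sqrt f)
  then obtain D where D: "\<forall>x. (f has_derivative D x) (at x)" "\<forall>v. elementary (\<lambda>x. D x v)"
    by blast
  have "((\<lambda>x. sqrt (f x)) has_derivative (\<lambda>v. 1/2 * (D x v * inverse (sqrt (f x))))) (at x)" for x
    by (rule has_derivative_eq_rhs, rule has_derivative_real_sqrt[OF sqrt.hyps(2) D(1)[rule_format]])
      (auto simp: field_simps)
  moreover have "sqrt (f x) \<noteq> 0" for x
    using sqrt.hyps(2)[of x] by simp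
  ultimately show ?case using D sqrt.hyps
    by (intro exI[of _ "\<lambda>x v. 1/2 * (D x v * inverse (sqrt (f x)))"])
      (intro conjI allI elementary.intros; blast intro: elementary.intros)
qed

lemma Ck_elementary:
  assumes "elementary f"
  shows "Ck k f"
  using assms
proof (induction k arbitrary: f)
  case 0
  then show ?case
    using elementary_has_derivative[of f]
    by (auto intro!: continuous_at_imp_continuous_on intro: has_derivative_continuous)
next
  case (Suc k)
  obtain D where D: "\<forall>x. (f has_derivative D x) (at x)" "\<forall>v. elementary (\<lambda>x. D x v)"
    using elementary_has_derivative[OF Suc.prems] by blast
  have "partial i f = (\<lambda>x. D x (axis i 1))" for i
    using D(1) partial_eqI by blast
  then show ?case
    using D Suc.IH by (auto simp: differentiable_def)
qed

lemma C_infinity_elementary: "elementary f \<Longrightarrow> C_infinity f"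
  by (simp add: C_infinity_def Ck_elementary)

section \<open>The operator on separable functions\<close>

lemma partial_separable:
  fixes F F' :: "'n::finite \<Rightarrow> real \<Rightarrow> real"
  assumes "\<And>i t. (F i has_real_derivative F' i t) (at t)"
  shows "partial i (\<lambda>x. \<Sum>j\<in>UNIV. F j (x $ j)) = (\<lambda>x. F' i (x $ i))"
proof
  fix x :: "real^'n"
  have "((\<lambda>x. F j (x $ j)) has_derivative (\<lambda>v. F' j (x $ j) * v $ j)) (at x)" for j
    by (rule has_derivative_compose[OF bounded_linear_imp_has_derivative[OF bounded_linear_vec_nth]
        assms[unfolded has_field_derivative_def]])
  then have "((\<lambda>x. \<Sum>j\<in>UNIV. F j (x $ j)) has_derivative (\<lambda>v. \<Sum>j\<in>UNIV. F' j (x $ j) * v $ j)) (at x)"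
    by (intro has_derivative_sum) auto
  from partial_eqI[OF this, of i]
  show "partial i (\<lambda>x. \<Sum>j\<in>UNIV. F j (x $ j)) x = F' i (x $ i)"
    by (simp add: axis_def if_distrib cong: if_cong)
qed

text \<open>Mixed second derivatives of a separable function vanish, so the Hessian is diagonal and
  only the diagonal of \<open>A \<rho> x\<close> enters the trace.\<close>

lemma L_separable:
  fixes F F' F'' :: "3 \<Rightarrow> real \<Rightarrow> real"
  assumes F: "\<And>i t. (F i has_real_derivative F' i t) (at t)"
    and F': "\<And>i t. (F' i has_real_derivative F'' i t) (at t)"
  shows "L b \<rho> (\<lambda>x. \<Sum>i\<in>UNIV. F i (x $ i)) x =
    - (F'' 1 (x $ 1) + F'' 2 (x $ 2) + (4 * ((x $ 1)\<^sup>2 + (x $ 2)\<^sup>2) + \<rho>\<^sup>2) * F'' 3 (x $ 3))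
    - (\<Sum>i\<in>UNIV. b x $ i * F' i (x $ i))"
proof -
  let ?w = "\<lambda>x. \<Sum>i\<in>UNIV. F i (x $ i)"
  have "partial i (partial j ?w) x = (if i = j then F'' i (x $ i) else 0)" for i j
  proof -
    \<comment> \<open>A first partial derivative is again separable, with zero summands away from
      \<open>j\<close>, so \<open>partial_separable\<close> applies a second time.\<close>
    have "partial j ?w = (\<lambda>x. \<Sum>i\<in>UNIV. (if i = j then F' i else (\<lambda>_. 0)) (x $ i))"
      unfolding partial_separable[OF F] by (simp add: fun_eq_iff if_distribR cong: if_cong)
    moreover have "partial i \<dots> = (\<lambda>x. (if i = j then F'' i else (\<lambda>_. 0)) (x $ i))"
      by (rule partial_separable[where F' = "\<lambda>i. if i = j then F'' i else (\<lambda>_. 0)"]) (use F' in auto)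
    ultimately show ?thesis
      by simp
  qed
  then have "hessian ?w x = (\<chi> i j. if i = j then F'' i (x $ i) else 0)"
    by (simp add: hessian_def)
  moreover have "gradient ?w x = (\<chi> i. F' i (x $ i))"
    by (simp add: gradient_def partial_separable[OF F])
  ultimately show ?thesis
    by (simp add: L_def A_explicit trace_def matrix_matrix_mult_def inner_vec_def sum_3)
qed

section \<open>The regularised profile\<close>

definition soft_sq :: "real \<Rightarrow> real \<Rightarrow> real" where
  "soft_sq E s = (s + sqrt (s\<^sup>2 + E))\<^sup>2 / 8"

definition soft_sq' :: "real \<Rightarrow> real \<Rightarrow> real" where
  "soft_sq' E s = (s + sqrt (s\<^sup>2 + E))\<^sup>2 / (4 * sqrt (s\<^sup>2 + E))"

definition soft_sq'' :: "real \<Rightarrow> real \<Rightarrow> real" where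
  "soft_sq'' E s = (s + sqrt (s\<^sup>2 + E))\<^sup>2 / (4 * (s\<^sup>2 + E)) * (2 - s / sqrt (s\<^sup>2 + E))"

context
  fixes E :: real
  assumes E: "E > 0"
begin

lemma sq_add_pos: "s\<^sup>2 + E > 0" for s :: real
  using E by (simp add: add_nonneg_pos)

lemma abs_less_sqrt: "\<bar>s\<bar> < sqrt (s\<^sup>2 + E)"
  using E real_sqrt_less_mono[of "s\<^sup>2" "s\<^sup>2 + E"] by simp

lemma sqrt_sq_add_deriv:
  "((\<lambda>s. sqrt (s\<^sup>2 + E)) has_real_derivative s / sqrt (s\<^sup>2 + E)) (at s)"
proof -
  have "((\<lambda>s. s\<^sup>2 + E) has_real_derivative 2 * s) (at s)"
    by (auto intro!: derivative_eq_intros)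
  from DERIV_chain2[OF DERIV_real_sqrt[OF sq_add_pos] this] show ?thesis
    by (simp add: field_simps)
qed

lemma add_sqrt_sq_deriv:
  "((\<lambda>s. (s + sqrt (s\<^sup>2 + E))\<^sup>2) has_real_derivative
    2 * (s + sqrt (s\<^sup>2 + E)) * (1 + s / sqrt (s\<^sup>2 + E))) (at s)"
  by (rule DERIV_cong[OF DERIV_power[OF DERIV_add[OF DERIV_ident sqrt_sq_add_deriv], where n = 2]]) simp

lemma soft_sq_deriv: "(soft_sq E has_real_derivative soft_sq' E s) (at s)"
proof -
  define q where "q = sqrt (s\<^sup>2 + E)"
  have q: "q > 0" using sq_add_pos by (simp add: q_def)
  have "(soft_sq E has_real_derivative 2 * (s + q) * (1 + s / q) / 8) (at s)"
    unfolding soft_sq_def[abs_def] q_def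
    by (rule DERIV_cdivide[OF add_sqrt_sq_deriv])
  also have "2 * (s + q) * (1 + s / q) / 8 = soft_sq' E s"
    unfolding soft_sq'_def q_def[symmetric] using q by (simp add: field_simps power2_eq_square)
  finally show ?thesis .
qed

lemma soft_sq'_deriv: "(soft_sq' E has_real_derivative soft_sq'' E s) (at s)"
proof -
  define q where "q = sqrt (s\<^sup>2 + E)"
  have q: "q > 0" "s\<^sup>2 + E = q\<^sup>2" using sq_add_pos[of s] by (auto simp: q_def less_imp_le)
  have "((\<lambda>s. 4 * sqrt (s\<^sup>2 + E)) has_real_derivative 4 * (s / q)) (at s)"
    unfolding q_def by (rule DERIV_cmult[OF sqrt_sq_add_deriv])
  moreover have "((\<lambda>s. (s + sqrt (s\<^sup>2 + E))\<^sup>2) has_real_derivative 2 * (s + q) * (1 + s / q)) (at s)"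
    unfolding q_def by (rule add_sqrt_sq_deriv)
  ultimately have "(soft_sq' E has_real_derivative
     (2 * (s + q) * (1 + s / q) * (4 * q) - (s + q)\<^sup>2 * (4 * (s / q))) / (4 * q * (4 * q))) (at s)"
    unfolding soft_sq'_def[abs_def] using q(1) unfolding q_def by (intro DERIV_divide) auto
  also have "(2 * (s + q) * (1 + s / q) * (4 * q) - (s + q)\<^sup>2 * (4 * (s / q))) / (4 * q * (4 * q)) = soft_sq'' E s"
    unfolding soft_sq''_def q_def[symmetric] q(2)
    using q(1) by (simp add: field_simps power2_eq_square)
  finally show ?thesis .
qed

section \<open>Bounds on the profile and its first two derivatives\<close>

lemma soft_sq_nonneg: "soft_sq E s \<ge> 0"
  by (simp add: soft_sq_def)

lemma soft_sq_ge: "soft_sq E s \<ge> s - 1/2"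
proof (cases "s \<ge> 0")
  case True
  have "(2 * s)\<^sup>2 \<le> (s + sqrt (s\<^sup>2 + E))\<^sup>2"
    using abs_less_sqrt[of s] True by (intro power_mono) auto
  moreover have "s\<^sup>2 \<ge> 2 * s - 1"
    using zero_le_power2[of "s - 1"] by (simp add: power2_eq_square algebra_simps)
  ultimately show ?thesis by (simp add: soft_sq_def)
next
  case False
  then show ?thesis using soft_sq_nonneg[of s] by linarith
qed

lemma soft_sq'_nonneg: "soft_sq' E s \<ge> 0"
  using sq_add_pos[of s] by (simp add: soft_sq'_def)

text \<open>With q = \<open>sqrt (s^2 + E)\<close>, the difference of the two sides is (s - q)^2 /
  (4 q).\<close>

lemma soft_sq'_ge: "soft_sq' E s \<ge> s"
proof -
  define q where "q = sqrt (s\<^sup>2 + E)"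
  have "q > 0" using sq_add_pos by (simp add: q_def)
  moreover have "(s - q)\<^sup>2 \<ge> 0" by simp
  ultimately show ?thesis
    unfolding soft_sq'_def q_def[symmetric] by (simp add: field_simps power2_eq_square)
qed

text \<open>Since q^2 - s^2 = E, the sum s + q equals E / (q - s), and here q - s \<ge> 2 a. Hence
  the derivative vanishes with \<open>E\<close> at a fixed distance to the left of 0.\<close>

lemma soft_sq'_le:
  assumes "a > 0" "s \<le> - a"
  shows "soft_sq' E s \<le> E / (8 * a)"
proof -
  define q where "q = sqrt (s\<^sup>2 + E)"
  have q: "q\<^sup>2 = s\<^sup>2 + E" "q > \<bar>s\<bar>"
    using sq_add_pos[of s] abs_less_sqrt[of s] by (auto simp: q_def)
  have "soft_sq' E s = (s + q) / 4 * ((s + q) / q)"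
    by (simp add: soft_sq'_def q_def power2_eq_square)
  also have "\<dots> \<le> (s + q) / 4 * 1"
    using q assms by (intro mult_left_mono) auto
  also have "s + q = E / (q - s)"
    using q by (simp add: field_simps power2_eq_square)
  also have "E / (q - s) / 4 * 1 \<le> E / (2 * a) / 4"
    using q assms E by (auto intro!: divide_left_mono divide_right_mono mult_pos_pos)
  finally show ?thesis by simp
qed

text \<open>As |s| < q, the first factor is at most 1 and the second lies between 0 and 3. The bound
  is free of \<open>E\<close>, so \<open>E\<close> may be shrunk later at no cost.\<close>

lemma soft_sq''_le: "soft_sq'' E s \<le> 3"
proof -
  define q where "q = sqrt (s\<^sup>2 + E)"
  have q: "q > \<bar>s\<bar>" "s\<^sup>2 + E = q\<^sup>2" using abs_less_sqrt sq_add_pos[of s] by (auto simp: q_def less_imp_le)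
  have "(s + q)\<^sup>2 \<le> (2 * q)\<^sup>2"
    using q by (intro power_mono) auto
  then have "(s + q)\<^sup>2 / (4 * q\<^sup>2) \<le> 1"
    using q by (simp add: field_simps power2_eq_square)
  moreover have "0 \<le> 2 - s / q" "2 - s / q \<le> 3"
    using q by (auto simp: field_simps abs_if split: if_splits)
  ultimately have "(s + q)\<^sup>2 / (4 * q\<^sup>2) * (2 - s / q) \<le> 1 * 3"
    by (intro mult_mono) auto
  moreover have "\<bar>q\<bar> = q" using q(1) by simp
  ultimately show ?thesis
    by (simp add: soft_sq''_def q(2))
qed

end

section \<open>The Lyapunov function\<close>

text \<open>For f(t) = \<open>soft_sq E (t^2 - 2 * X^2)\<close> the left side is -f'' - \<beta> f' -
  4 t^2. Outside [-X, X] the drift dominates; inside, \<open>small\<close> makes f' harmless. The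
  bound \<open>K\<close> acts only through \<open>E\<close>, so the final constant depends on
  \<open>X\<close> alone.\<close>

lemma one_dim_estimate:
  fixes \<beta> :: "real \<Rightarrow> real"
  assumes E: "E > 0" and X: "X > 0"
    and out: "\<And>t. \<bar>t\<bar> \<ge> X \<Longrightarrow> t * \<beta> t \<le> - 18"
    and ins: "\<And>t. \<bar>t\<bar> \<le> X \<Longrightarrow> \<bar>\<beta> t\<bar> \<le> K"
    and small: "E * (X * K + 1) \<le> 4 * X\<^sup>2"
  defines "s t \<equiv> t\<^sup>2 - 2 * X\<^sup>2"
  shows "- (2 * soft_sq' E (s t) + 4 * t\<^sup>2 * soft_sq'' E (s t)) - \<beta> t * (2 * t * soft_sq' E (s t)) - 4 * t\<^sup>2
    \<ge> t\<^sup>2 - (68 * X\<^sup>2 + 1)"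
proof -
  note nn = soft_sq'_nonneg[OF E, of "s t"]
  have eq: "- (2 * soft_sq' E (s t) + 4 * t\<^sup>2 * soft_sq'' E (s t)) - \<beta> t * (2 * t * soft_sq' E (s t)) - 4 * t\<^sup>2
    = - 2 * ((t * \<beta> t + 1) * soft_sq' E (s t)) - 4 * (t\<^sup>2 * soft_sq'' E (s t)) - 4 * t\<^sup>2"
    by (simp add: algebra_simps)
  have 2: "t\<^sup>2 * soft_sq'' E (s t) \<le> t\<^sup>2 * 3"
    by (intro mult_left_mono soft_sq''_le E) auto
  show ?thesis
  proof (cases "\<bar>t\<bar> \<ge> X")
    case True
    \<comment> \<open>The factor -17 turns into a gain of at least 34 (t^2 - 2 X^2), which beats the
      loss 12 t^2 + 4 t^2 and produces the constant 68 X^2.\<close>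
    have "(t * \<beta> t + 1) * soft_sq' E (s t) \<le> - 17 * soft_sq' E (s t)"
      using out[OF True] by (intro mult_right_mono nn) simp
    moreover have "t\<^sup>2 \<le> 2 * X\<^sup>2 + soft_sq' E (s t)"
      using soft_sq'_ge[OF E, of "s t"] by (simp add: s_def)
    ultimately show ?thesis
      unfolding eq using 2 zero_le_power2[of t] by linarith
  next
    case False
    then have t2: "t\<^sup>2 \<le> X\<^sup>2"
      using X by (metis abs_le_square_iff abs_of_pos linear)
    have K: "K \<ge> 0" using ins[of 0] X by force
    have "\<bar>t * \<beta> t\<bar> \<le> X * K"
      unfolding abs_mult using False X ins[of t] by (intro mult_mono) auto
    then have "(t * \<beta> t + 1) * soft_sq' E (s t) \<le> (X * K + 1) * soft_sq' E (s t)"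
      by (intro mult_right_mono nn) auto
    \<comment> \<open>The shift by 2 X^2 gives \<open>s t\<close> \<le> -X^2 here, so
      \<open>soft_sq'_le\<close> applies with a = X^2.\<close>
    also have "\<dots> \<le> (X * K + 1) * (E / (8 * X\<^sup>2))"
      using X K t2 by (intro mult_left_mono soft_sq'_le E) (auto simp: s_def)
    also have "\<dots> \<le> 1 / 2"
      using X small by (simp add: field_simps)
    finally show ?thesis
      unfolding eq using 2 t2 zero_le_power2[of X] by linarith
  qed
qed

section \<open>Smoothness and growth of the function, and its image under the operator\<close>

definition lyapunov :: "real \<Rightarrow> real \<Rightarrow> real^3 \<Rightarrow> real" where
  "lyapunov X E x = soft_sq E ((x $ 1)\<^sup>2 - 2 * X\<^sup>2) + soft_sq E ((x $ 2)\<^sup>2 - 2 * X\<^sup>2) + (x $ 3)\<^sup>2 / 2"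

lemma norm_sq_3: "(norm x)\<^sup>2 = (x $ 1)\<^sup>2 + (x $ 2)\<^sup>2 + (x $ 3)\<^sup>2" for x :: "real^3"
  unfolding power2_norm_eq_inner by (simp add: inner_vec_def sum_3 power2_eq_square)

lemma C_infinity_lyapunov:
  assumes "E > 0"
  shows "C_infinity (lyapunov X E)"
proof -
  have sq: "elementary (\<lambda>x. (g x)\<^sup>2)" if "elementary g" for g :: "real^3 \<Rightarrow> real"
    using elementary.mult[OF that that] by (simp add: power2_eq_square)
  have soft: "elementary (\<lambda>x. soft_sq E (g x))" if g: "elementary g" for g :: "real^3 \<Rightarrow> real"
  proof -
    have "elementary (\<lambda>x. 1/8 * (g x + sqrt ((g x)\<^sup>2 + E))\<^sup>2)"
      by (intro sq elementary.intros g sq_add_pos[OF assms])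
    then show ?thesis by (simp add: soft_sq_def)
  qed
  have "elementary (\<lambda>x::real^3. soft_sq E ((x $ 1)\<^sup>2 + - (2 * X\<^sup>2)) + soft_sq E ((x $ 2)\<^sup>2 + - (2 * X\<^sup>2))
      + 1/2 * (x $ 3)\<^sup>2)"
    by (intro soft sq elementary.intros)
  then have "elementary (lyapunov X E)"
    by (simp add: lyapunov_def[abs_def])
  then show ?thesis by (rule C_infinity_elementary)
qed

lemma lyapunov_nonneg: "E > 0 \<Longrightarrow> lyapunov X E x \<ge> 0"
  by (simp add: lyapunov_def soft_sq_nonneg)

text \<open>By \<open>soft_sq_ge\<close> the two profile terms are at least x_1^2 + x_2^2 - 4 X^2 -
  1, so |x|^2 / 2 is a minorant up to a constant.\<close>

lemma lyapunov_at_top: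
  assumes "E > 0"
  shows "filterlim (lyapunov X E) at_top at_infinity"
proof (rule filterlim_at_top_mono)
  show "filterlim (\<lambda>x::real^3. - (4 * X\<^sup>2 + 1) + (norm x)\<^sup>2 * (1/2)) at_top at_infinity"
    by (intro filterlim_tendsto_add_at_top[OF tendsto_const]
        filterlim_at_top_mult_tendsto_pos[OF tendsto_const] filterlim_pow_at_top
        filterlim_norm_at_top) auto
  show "\<forall>\<^sub>F x in at_infinity. - (4 * X\<^sup>2 + 1) + (norm x)\<^sup>2 * (1/2) \<le> lyapunov X E x"
  proof (rule always_eventually, rule allI)
    fix x :: "real^3"
    show "- (4 * X\<^sup>2 + 1) + (norm x)\<^sup>2 * (1/2) \<le> lyapunov X E x"
      using soft_sq_ge[OF assms, of "(x $ 1)\<^sup>2 - 2 * X\<^sup>2"] soft_sq_ge[OF assms, of "(x $ 2)\<^sup>2 - 2 * X\<^sup>2"]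
        zero_le_power2[of "x $ 1"] zero_le_power2[of "x $ 2"]
      unfolding lyapunov_def norm_sq_3 distrib_right by linarith
  qed
qed

text \<open>The degenerate entry contributes 4 x_1^2 + 4 x_2^2; one piece goes to each of the
  coordinates 1 and 2, to match \<open>one_dim_estimate\<close>.\<close>

lemma L_lyapunov:
  fixes X :: real
  assumes E: "E > 0"
  defines "s t \<equiv> t\<^sup>2 - 2 * X\<^sup>2"
  shows "L b \<rho> (lyapunov X E) x =
    (\<Sum>i\<in>{1, 2}. - (2 * soft_sq' E (s (x $ i)) + 4 * (x $ i)\<^sup>2 * soft_sq'' E (s (x $ i)))
      - b x $ i * (2 * x $ i * soft_sq' E (s (x $ i))) - 4 * (x $ i)\<^sup>2)
    - \<rho>\<^sup>2 - b x $ 3 * x $ 3"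
proof -
  define F :: "3 \<Rightarrow> real \<Rightarrow> real" where
    "F i = (if i = 3 then (\<lambda>t. t\<^sup>2 / 2) else (\<lambda>t. soft_sq E (s t)))" for i
  define F' :: "3 \<Rightarrow> real \<Rightarrow> real" where
    "F' i = (if i = 3 then (\<lambda>t. t) else (\<lambda>t. 2 * t * soft_sq' E (s t)))" for i
  define F'' :: "3 \<Rightarrow> real \<Rightarrow> real" where
    "F'' i = (if i = 3 then (\<lambda>t. 1) else (\<lambda>t. 2 * soft_sq' E (s t) + 4 * t\<^sup>2 * soft_sq'' E (s t)))" for i
  have s: "(s has_real_derivative 2 * t) (at t)" for t
    unfolding s_def by (auto intro!: derivative_eq_intros)
  note chain = DERIV_chain2[OF soft_sq_deriv[OF E] s, THEN DERIV_cong]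
    DERIV_chain2[OF soft_sq'_deriv[OF E] s, THEN DERIV_cong]
  have "(F i has_real_derivative F' i t) (at t)" for i t
    by (auto simp: F_def F'_def intro!: derivative_eq_intros chain)
  moreover have "(F' i has_real_derivative F'' i t) (at t)" for i t
    by (auto simp: F'_def F''_def power2_eq_square intro!: derivative_eq_intros chain)
  ultimately have "L b \<rho> (\<lambda>x. \<Sum>i\<in>UNIV. F i (x $ i)) x =
    - (F'' 1 (x $ 1) + F'' 2 (x $ 2) + (4 * ((x $ 1)\<^sup>2 + (x $ 2)\<^sup>2) + \<rho>\<^sup>2) * F'' 3 (x $ 3))
    - (\<Sum>i\<in>UNIV. b x $ i * F' i (x $ i))"
    by (rule L_separable)
  moreover have "lyapunov X E = (\<lambda>x. \<Sum>i\<in>UNIV. F i (x $ i))"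
    by (simp add: fun_eq_iff lyapunov_def F_def sum_3 s_def)
  ultimately show ?thesis
    by (simp add: F'_def F''_def sum_3 algebra_simps)
qed

text \<open>The threshold in \<open>drift3\<close> is twice 68 X^2 + 1, plus 1 for \<rho>^2 and 1
  for the required lower bound. It involves no bound of \<open>b\<close> on compact sets, which is
  what makes \<alpha> = 0 accessible.\<close>

lemma exists_lyapunov:
  fixes b :: "real^3 \<Rightarrow> real^3"
  assumes cont: "continuous_on UNIV b"
    and sep: "\<And>i x y. x $ i = y $ i \<Longrightarrow> b x $ i = b y $ i"
    and X: "X > 0" and Y: "Y > 0"
    and drift12: "\<And>i x. i \<noteq> 3 \<Longrightarrow> \<bar>x $ i\<bar> \<ge> X \<Longrightarrow> x $ i * b x $ i \<le> - 18"
    and drift3: "\<And>x. \<bar>x $ 3\<bar> \<ge> Y \<Longrightarrow> x $ 3 * b x $ 3 \<le> - (136 * X\<^sup>2 + 4)"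
  shows "\<exists>R0>0. \<exists>w. C_infinity w \<and>
      (\<exists>\<rho>0>0. \<forall>\<rho>. 0 < \<rho> \<and> \<rho> < \<rho>0 \<longrightarrow>
        (\<forall>x. x \<notin> closure (ball 0 R0) \<longrightarrow> L b \<rho> w x \<ge> 1)) \<and>
      (\<forall>x. x \<notin> closure (ball 0 R0) \<longrightarrow> w x \<ge> 0) \<and>
      filterlim w at_top at_infinity"
proof -
  \<comment> \<open>Each component depends on one coordinate, so its values can be read off on the
    diagonal.\<close>
  define \<beta> where "\<beta> i t = b (\<chi> j. t) $ i" for i t
  have b\<beta>: "b x $ i = \<beta> i (x $ i)" for x i
    unfolding \<beta>_def by (rule sep) simp
  have "continuous_on {- (X + Y)..X + Y} (\<lambda>t. b (\<chi> j. t))"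
    by (intro continuous_on_compose2[OF cont] continuous_intros) auto
  then have "bounded ((\<lambda>t. b (\<chi> j. t)) ` {- (X + Y)..X + Y})"
    by (intro compact_imp_bounded compact_continuous_image) auto
  then obtain K where "K > 0" and K_le: "\<And>t. t \<in> {- (X + Y)..X + Y} \<Longrightarrow> norm (b (\<chi> j. t)) \<le> K"
    unfolding bounded_pos by (meson imageI)
  have K: "K > 0" "\<And>t. \<bar>t\<bar> \<le> X + Y \<Longrightarrow> norm (b (\<chi> j. t)) \<le> K"
    using \<open>K > 0\<close> by (auto intro!: K_le)
  have \<beta>K: "\<bar>\<beta> i t\<bar> \<le> K" if "\<bar>t\<bar> \<le> X + Y" for i t
    unfolding \<beta>_def by (rule order_trans[OF component_le_norm_cart K(2)[OF that]])
  \<comment> \<open>This choice turns the smallness condition of \<open>one_dim_estimate\<close>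
    into an equality.\<close>
  define E where "E = 4 * X\<^sup>2 / (X * K + 1)"
  have XK: "X * K + 1 > 0" using X K by (simp add: add_pos_pos)
  then have E: "E > 0" and EX: "E * (X * K + 1) \<le> 4 * X\<^sup>2"
    using X by (auto simp: E_def)
  \<comment> \<open>If |x| \<ge> \<open>R0\<close> and |x_3| < \<open>Y\<close>, then x_1^2 + x_2^2
    \<ge> 136 X^2 + 4 + K Y, where K Y pays for the uncontrolled term b_3 x_3.\<close>
  define R0 where "R0 = sqrt (136 * X\<^sup>2 + 4 + K * Y + Y\<^sup>2)"
  have pos: "136 * X\<^sup>2 + 4 + K * Y + Y\<^sup>2 > 0"
    using X Y K by (intro add_pos_pos) auto
  have R0: "R0 > 0" "R0\<^sup>2 = 136 * X\<^sup>2 + 4 + K * Y + Y\<^sup>2"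
    using pos by (auto simp: R0_def)
  have "L b \<rho> (lyapunov X E) x \<ge> 1"
    if \<rho>: "0 < \<rho>" "\<rho> < 1" and x: "x \<notin> closure (ball 0 R0)" for \<rho> x
  proof -
    have "norm x \<ge> R0"
      using x R0 by auto
    then have "(norm x)\<^sup>2 \<ge> R0\<^sup>2"
      using R0 by (intro power_mono) auto
    then have nx: "(x $ 1)\<^sup>2 + (x $ 2)\<^sup>2 + (x $ 3)\<^sup>2 \<ge> 136 * X\<^sup>2 + 4 + K * Y + Y\<^sup>2"
      using norm_sq_3[of x] R0 by simp
    have "\<rho>\<^sup>2 \<le> 1"
      using \<rho> by (simp add: power_le_one)
    have est: "- (2 * soft_sq' E ((x $ i)\<^sup>2 - 2 * X\<^sup>2) + 4 * (x $ i)\<^sup>2 * soft_sq'' E ((x $ i)\<^sup>2 - 2 * X\<^sup>2))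
      - b x $ i * (2 * x $ i * soft_sq' E ((x $ i)\<^sup>2 - 2 * X\<^sup>2)) - 4 * (x $ i)\<^sup>2
      \<ge> (x $ i)\<^sup>2 - (68 * X\<^sup>2 + 1)" if "i \<noteq> 3" for i
      unfolding b\<beta>
    proof (rule one_dim_estimate[OF E X _ _ EX])
      show "t * \<beta> i t \<le> - 18" if "\<bar>t\<bar> \<ge> X" for t
        using drift12[OF \<open>i \<noteq> 3\<close>, of "\<chi> j. t"] that by (simp add: \<beta>_def)
      show "\<bar>\<beta> i t\<bar> \<le> K" if "\<bar>t\<bar> \<le> X" for t
        using \<beta>K that Y by simp
    qed
    have L: "L b \<rho> (lyapunov X E) x \<ge> (x $ 1)\<^sup>2 + (x $ 2)\<^sup>2 - 2 * (68 * X\<^sup>2 + 1) - 1 - x $ 3 * b x $ 3"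
      using est[of 1] est[of 2] \<open>\<rho>\<^sup>2 \<le> 1\<close> unfolding L_lyapunov[OF E] by (simp add: mult.commute)
    show ?thesis
    proof (cases "\<bar>x $ 3\<bar> \<ge> Y")
      case True
      have "(x $ 1)\<^sup>2 + (x $ 2)\<^sup>2 \<ge> 0" by simp
      with L drift3[OF True] show ?thesis by argo
    next
      case False
      have "\<bar>x $ 3 * b x $ 3\<bar> \<le> Y * K"
        unfolding abs_mult b\<beta> using False X Y \<beta>K[of "x $ 3" 3] by (intro mult_mono) auto
      moreover have "(x $ 3)\<^sup>2 \<le> Y\<^sup>2"
        using False Y by (metis abs_le_square_iff abs_of_pos linear)
      ultimately show ?thesis
        using L nx by (simp add: mult.commute)
    qed
  qed
  then show ?thesis
    using R0(1) C_infinity_lyapunov[OF E] lyapunov_nonneg[OF E] lyapunov_at_top[OF E]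
    by (intro exI[of _ R0] exI[of _ "lyapunov X E"] conjI exI[of _ 1]) auto
qed

section \<open>From the drift condition to the radii and the size of the constants\<close>

lemma confining_drift_mult_le:
  assumes "confining_drift b \<alpha> R C" "R > 0" "\<bar>x $ i\<bar> \<ge> R"
  shows "x $ i * b x $ i \<le> - (C $ i * \<bar>x $ i\<bar> powr \<alpha>)"
proof -
  let ?c = "C $ i / \<bar>x $ i\<bar> powr (1 - \<alpha>)"
  have pos: "\<bar>x $ i\<bar> > 0" using assms by linarith
  \<comment> \<open>Multiplying by |x_i| turns the exponent \<alpha> - 1 into \<alpha>: a growing
    bound for \<alpha> > 0, the constant C_i for \<alpha> = 0.\<close>
  have eq: "\<bar>x $ i\<bar> * ?c = C $ i * \<bar>x $ i\<bar> powr \<alpha>"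
    using pos by (simp add: powr_diff field_simps)
  consider "x $ i \<ge> R" | "x $ i \<le> - R" using assms(3) by linarith
  then have "x $ i * b x $ i \<le> - (\<bar>x $ i\<bar> * ?c)"
  proof cases
    case 1
    then have "b x $ i \<le> - ?c" using assms(1) unfolding confining_drift_def by blast
    from mult_left_mono[OF this, of "\<bar>x $ i\<bar>"] show ?thesis
      using 1 assms(2) by simp
  next
    case 2
    then have "?c \<le> b x $ i" using assms(1) unfolding confining_drift_def by blast
    from mult_left_mono[OF this, of "\<bar>x $ i\<bar>"] show ?thesis
      using 2 assms(2) by simp
  qed
  then show ?thesis using eq by simp
qed

lemma mult_powr_ge_large:
  fixes c \<alpha> m r :: real
  assumes "c > 0" "\<alpha> > 0"
  shows "\<exists>X\<ge>r. \<forall>t\<ge>X. c * t powr \<alpha> \<ge> m"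
proof -
  \<comment> \<open>The radius solves c N^\<alpha> = |m|; the absolute value keeps the base of the
    power nonnegative.\<close>
  let ?N = "(\<bar>m\<bar> / c) powr (1 / \<alpha>)"
  have "c * t powr \<alpha> \<ge> m" if "t \<ge> ?N" for t
  proof -
    have "\<bar>m\<bar> / c = ?N powr \<alpha>"
      using assms by (simp add: powr_powr)
    also have "\<dots> \<le> t powr \<alpha>"
      using that assms by (intro powr_mono2) auto
    finally show ?thesis
      using assms by (simp add: field_simps)
  qed
  then show ?thesis
    by (intro exI[of _ "max r ?N"]) auto
qed

theorem lemma2p2:
  fixes R :: real
  assumes "R > 0"
  shows "\<exists>M>0. \<forall>(\<alpha>::real) (C::real^3) (b::real^3 \<Rightarrow> real^3).
    \<alpha> \<ge> 0 \<and> (\<forall>i. C$i > 0) \<and> confining_drift b \<alpha> R C \<and>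
    (\<alpha> > 0 \<or> \<alpha> = 0 \<and> (\<forall>i. C$i \<ge> M)) \<longrightarrow>
    (\<exists>R0>0. \<exists>w::real^3 \<Rightarrow> real. C_infinity w \<and>
      (\<exists>\<rho>0>0. \<forall>\<rho>. 0 < \<rho> \<and> \<rho> < \<rho>0 \<longrightarrow>
        (\<forall>x. x \<notin> closure (ball 0 R0) \<longrightarrow> L b \<rho> w x \<ge> 1)) \<and>
      (\<forall>x. x \<notin> closure (ball 0 R0) \<longrightarrow> w x \<ge> 0) \<and>
      filterlim w at_top at_infinity)"
proof -
  \<comment> \<open>Dominates both thresholds for X = R, namely 18 and 136 R^2 + 4.\<close>
  define M where "M = 136 * R\<^sup>2 + 18"
  have "M > 0" by (simp add: M_def add_nonneg_pos)
  show ?thesis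
  proof (rule exI[of _ M], intro conjI \<open>M > 0\<close> allI impI, elim conjE)
    fix \<alpha> :: real and C :: "real^3" and b :: "real^3 \<Rightarrow> real^3"
    assume C: "\<forall>i. C $ i > 0" and drift: "confining_drift b \<alpha> R C"
      and cases: "\<alpha> > 0 \<or> \<alpha> = 0 \<and> (\<forall>i. C $ i \<ge> M)"
    \<comment> \<open>\<open>X\<close> is fixed before \<open>Y\<close>, whose threshold depends on
      it. For \<alpha> > 0 both are taken large; for \<alpha> = 0 both equal
      \<open>R\<close>.\<close>
    have "\<exists>X\<ge>R. \<exists>Y\<ge>R. (\<forall>i. \<forall>t\<ge>X. C $ i * t powr \<alpha> \<ge> 18) \<and> (\<forall>t\<ge>Y. C $ 3 * t powr \<alpha> \<ge> 136 * X\<^sup>2 + 4)"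
      using cases
    proof (elim disjE conjE)
      assume "\<alpha> > 0"
      then have large: "\<exists>X\<ge>R. \<forall>t\<ge>X. C $ i * t powr \<alpha> \<ge> m" for m i
        using C mult_powr_ge_large by blast
      obtain X where X: "\<And>i. X i \<ge> R" "\<And>i t. t \<ge> X i \<Longrightarrow> C $ i * t powr \<alpha> \<ge> 18"
        using large[where m = 18] by metis
      define X0 where "X0 = Max (range X)"
      have X0: "X0 \<ge> X i" for i by (simp add: X0_def)
      obtain Y where "Y \<ge> R" "\<forall>t\<ge>Y. C $ 3 * t powr \<alpha> \<ge> 136 * X0\<^sup>2 + 4"
        using large by blast
      moreover have "X0 \<ge> R" "\<forall>i. \<forall>t\<ge>X0. C $ i * t powr \<alpha> \<ge> 18"
        using X X0 order_trans by blast+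
      ultimately show ?thesis by blast
    next
      assume "\<alpha> = 0" "\<forall>i. C $ i \<ge> M"
      moreover have "M \<ge> 18" "M \<ge> 136 * R\<^sup>2 + 4" by (simp_all add: M_def)
      \<comment> \<open>Here t \<ge> R > 0 gives \<open>t powr 0 = 1\<close>, whereas
        \<open>0 powr 0 = 0\<close>.\<close>
      ultimately have "C $ i * t powr \<alpha> \<ge> 18" "C $ i * t powr \<alpha> \<ge> 136 * R\<^sup>2 + 4" if "t \<ge> R" for i t
        using that assms by (auto intro: order_trans)
      then show ?thesis by blast
    qed
    then obtain X Y where XY: "X \<ge> R" "Y \<ge> R" "\<And>i t. t \<ge> X \<Longrightarrow> C $ i * t powr \<alpha> \<ge> 18"
      "\<And>t. t \<ge> Y \<Longrightarrow> C $ 3 * t powr \<alpha> \<ge> 136 * X\<^sup>2 + 4"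
      by blast
    show "\<exists>R0>0. \<exists>w::real^3 \<Rightarrow> real. C_infinity w \<and>
      (\<exists>\<rho>0>0. \<forall>\<rho>. 0 < \<rho> \<and> \<rho> < \<rho>0 \<longrightarrow>
        (\<forall>x. x \<notin> closure (ball 0 R0) \<longrightarrow> L b \<rho> w x \<ge> 1)) \<and>
      (\<forall>x. x \<notin> closure (ball 0 R0) \<longrightarrow> w x \<ge> 0) \<and>
      filterlim w at_top at_infinity"
    proof (rule exists_lyapunov[where X = X and Y = Y])
      show "continuous_on UNIV b" "\<And>i x y. x $ i = y $ i \<Longrightarrow> b x $ i = b y $ i"
        using drift unfolding confining_drift_def by blast+
      show "X > 0" "Y > 0" using XY assms by auto
      show "x $ i * b x $ i \<le> - 18" if "i \<noteq> 3" and that: "\<bar>x $ i\<bar> \<ge> X" for i x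
        using confining_drift_mult_le[OF drift assms, of x i] XY(1) XY(3)[OF that, of i] that by linarith
      show "x $ 3 * b x $ 3 \<le> - (136 * X\<^sup>2 + 4)" if "\<bar>x $ 3\<bar> \<ge> Y" for x
        using confining_drift_mult_le[OF drift assms, of x 3] XY(2) XY(4)[OF that] that by linarith
    qed
  qed
qed

end
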